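(* If $0<q\le 1$, then there exists a constant $c>0$ such that, for any integer $d\ge1$ and any $r,\sigma>0$, we have $$R^*_L(B_q(r)) \ge c\,\psi^L_{\sigma,q}(r,d).$$
   Context: Model: one observes $y_j=\theta_j+\sigma\xi_j$, $j=1,\dots,d$, where $\theta=(\theta_1,\dots,\theta_d)\in\mathbb R^d$ is an unknown vector of parameters, $\xi_j$ are i.i.d. standard normal random variables and $\sigma>0$ is the noise level. $\mathbf P_\theta$ is the probability measure of the vector of observations $(y_1,\dots,y_d)$ and $\mathbf E_\theta$ the corresponding expectation. $L(\theta)=\sum_{i=1}^d\theta_i$; $\|\theta\|_q=\big(\sum_{i=1}^d|\theta_i|^q\big)^{1/q}$; $B_q(r)=\{\theta\in\mathbb R^d:\|\theta\|_q\le r\}$. The minimax risk is $$R^*_L(B_q(r))=\inf_{\hat T}\sup_{\theta\in B_q(r)}\mathbf E_\theta\big(\hat T-L(\theta)\big)^2,$$ where $\inf_{\hat T}$ denotes the infimum over all estimators (functions of the observations). For any $r,\sigma,q>0$ and any integer $d\ge1$, the integer $m$ is defined by $$m=\max\{s\ge 1:\ \sigma^2\log(1+d/s^2)\le r^2s^{-2/q},\ s\in\mathbb N\}$$ if the set $\{s\ge 1:\ \sigma^2\log(1+d/s^2)\le r^2s^{-2/q},\ s\in\mathbb N\}$ is non-empty, and $m=0$ if this set is empty. The rate is $$\psi^L_{\sigma,q}(r,d)=\begin{cases}\sigma^2m^2\log(1+d/m^2)&\text{if } m\ge1,\\ r^2&\text{if } m=0.\end{cases}$$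
   Formalization: For q = 1 and r² ≥ σ²d the set defining m is all of {1,2,…} and has no maximum; there m is taken to be infinite and ψ is set to σ²d, the limit and supremum over m of σ²m² log(1+d/m²). Elsewhere the definition is unchanged. *)

theory Defs
  imports "HOL-Probability.Probability" "HOL-Library.Extended_Nat" "HOL-Real_Asymp.Real_Asymp"
begin

text \<open>
  The dimension \<open>d\<close> is quantified inside the statement (after the constant), so a vector of
  \<open>\<real>\<^sup>d\<close> is an extensional function on the index set \<open>{1..d}\<close>.
\<close>

definition Rvec :: "nat \<Rightarrow> (nat \<Rightarrow> real) set" where
  "Rvec d = {1..d} \<rightarrow>\<^sub>E UNIV"

definition borel_vec :: "nat \<Rightarrow> (nat \<Rightarrow> real) measure" where
  "borel_vec d = (\<Pi>\<^sub>M j\<in>{1..d}. borel)"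

definition noise_law :: "nat \<Rightarrow> (nat \<Rightarrow> real) measure" where
  "noise_law d = (\<Pi>\<^sub>M j\<in>{1..d}. density lborel std_normal_density)"

text \<open>The law \<open>P\<^sub>\<theta>\<close> of the observations \<open>y\<^sub>j = \<theta>\<^sub>j + \<sigma> \<xi>\<^sub>j\<close>.\<close>

definition obs_law :: "nat \<Rightarrow> real \<Rightarrow> (nat \<Rightarrow> real) \<Rightarrow> (nat \<Rightarrow> real) measure" where
  "obs_law d \<sigma> \<theta> =
     distr (noise_law d) (borel_vec d) (\<lambda>\<xi>. \<lambda>j\<in>{1..d}. \<theta> j + \<sigma> * \<xi> j)"

definition linear_functional :: "nat \<Rightarrow> (nat \<Rightarrow> real) \<Rightarrow> real" where
  "linear_functional d \<theta> = (\<Sum>i=1..d. \<theta> i)"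

definition q_norm :: "nat \<Rightarrow> real \<Rightarrow> (nat \<Rightarrow> real) \<Rightarrow> real" where
  "q_norm d q \<theta> = (\<Sum>i=1..d. \<bar>\<theta> i\<bar> powr q) powr (1 / q)"

definition q_ball :: "nat \<Rightarrow> real \<Rightarrow> real \<Rightarrow> (nat \<Rightarrow> real) set" where
  "q_ball d q r = {\<theta> \<in> Rvec d. q_norm d q \<theta> \<le> r}"

text \<open>
  Expected squared errors are nonnegative Lebesgue integrals with values in \<open>[0, \<infinity>]\<close>, so that
  estimators with infinite risk are treated correctly; a Bochner integral would be 0 for them.
\<close>

definition mean_squared_error ::
    "nat \<Rightarrow> real \<Rightarrow> ((nat \<Rightarrow> real) \<Rightarrow> real) \<Rightarrow> (nat \<Rightarrow> real) \<Rightarrow> ennreal" where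
  "mean_squared_error d \<sigma> T \<theta> =
     (\<integral>\<^sup>+ y. ennreal ((T y - linear_functional d \<theta>)\<^sup>2) \<partial>obs_law d \<sigma> \<theta>)"

definition minimax_risk :: "nat \<Rightarrow> real \<Rightarrow> (nat \<Rightarrow> real) set \<Rightarrow> ennreal" where
  "minimax_risk d \<sigma> \<Theta> =
     (INF T \<in> borel_measurable (borel_vec d). SUP \<theta> \<in> \<Theta>. mean_squared_error d \<sigma> T \<theta>)"

definition sparsity_set :: "nat \<Rightarrow> real \<Rightarrow> real \<Rightarrow> real \<Rightarrow> nat set" where
  "sparsity_set d \<sigma> q r =
     {s. s \<ge> 1 \<and> \<sigma>\<^sup>2 * ln (1 + real d / (real s)\<^sup>2) \<le> r\<^sup>2 * real s powr (- 2 / q)}"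

text \<open>
  For \<open>q < 1\<close> the set is always finite. For \<open>q = 1\<close> it is the whole of \<open>{1..}\<close> as soon as
  \<open>\<sigma>\<^sup>2 d \<le> r\<^sup>2\<close>, and then has no maximum; the convention \<open>m = \<infinity>\<close> is used in this case.
\<close>

definition sparsity_level :: "nat \<Rightarrow> real \<Rightarrow> real \<Rightarrow> real \<Rightarrow> enat" where
  "sparsity_level d \<sigma> q r =
     (let S = sparsity_set d \<sigma> q r in
      if S = {} then 0 else if finite S then enat (Max S) else \<infinity>)"

text \<open>
  The value at \<open>m = \<infinity>\<close> is the limit (and supremum) over \<open>m\<close> of the expression for finite
  \<open>m \<ge> 1\<close>; see the two lemmas below.
\<close>

definition rate :: "nat \<Rightarrow> real \<Rightarrow> real \<Rightarrow> real \<Rightarrow> real" where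
  "rate d \<sigma> q r =
     (case sparsity_level d \<sigma> q r of
        enat m \<Rightarrow> if m \<ge> 1 then \<sigma>\<^sup>2 * (real m)\<^sup>2 * ln (1 + real d / (real m)\<^sup>2) else r\<^sup>2
      | \<infinity> \<Rightarrow> \<sigma>\<^sup>2 * real d)"

lemma rate_at_infinity_limit:
  "(\<lambda>m. \<sigma>\<^sup>2 * (real m)\<^sup>2 * ln (1 + real d / (real m)\<^sup>2)) \<longlonglongrightarrow> \<sigma>\<^sup>2 * real d"
proof (cases "d = 0")
  case False
  define a where "a = real d"
  have "a > 0" using False by (simp add: a_def)
  then have "(\<lambda>m. (real m)\<^sup>2 * ln (1 + a / (real m)\<^sup>2)) \<longlonglongrightarrow> a"
    by real_asymp
  from tendsto_mult_left[OF this, of "\<sigma>\<^sup>2"] show ?thesis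
    by (simp add: a_def mult.assoc)
qed simp

lemma rate_at_infinity_bound:
  assumes "m \<ge> 1"
  shows "\<sigma>\<^sup>2 * (real m)\<^sup>2 * ln (1 + real d / (real m)\<^sup>2) \<le> \<sigma>\<^sup>2 * real d"
proof -
  have "(real m)\<^sup>2 * ln (1 + real d / (real m)\<^sup>2) \<le> (real m)\<^sup>2 * (real d / (real m)\<^sup>2)"
    by (intro mult_left_mono ln_add_one_self_le_self) auto
  also have "\<dots> = real d" using assms by simp
  finally show ?thesis
    by (simp add: mult.assoc mult_left_mono)
qed

end

theory Submission
  imports Defs
begin

text \<open>
  The law \<open>P\<^sub>0\<close> is tested against a mixture of laws \<open>P\<^sub>\<theta>\<close>, where \<open>\<theta>\<close> has \<open>s\<close> entries equal to
  \<open>\<rho>\<close>, one at a uniformly random position in each of \<open>s\<close> blocks of length \<open>b = d div s\<close>, so that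
  \<open>L(\<theta>) = s \<rho>\<close> throughout the mixture. The second moment of the likelihood ratio of the mixture is
  \<open>(1 + (exp (\<rho>\<^sup>2 / \<sigma>\<^sup>2) - 1) / b) ^ s\<close>, which is at most \<open>2\<close> if
  \<open>4 \<rho>\<^sup>2 \<le> \<sigma>\<^sup>2 ln (1 + d / s\<^sup>2)\<close>; every estimator then has risk at least \<open>(s \<rho>)\<^sup>2 / 8\<close>.
  One takes \<open>s = 1\<close>, \<open>\<rho> = r / 2\<close> if \<open>m = 0\<close>, and otherwise the largest admissible \<open>\<rho>\<close> with
  \<open>s = min m d\<close>; for \<open>m \<ge> d\<close>, \<open>q \<le> 1\<close> ensures that \<open>s = d\<close> satisfies the condition defining \<open>m\<close>
  up to a constant factor, and the rate is at most \<open>\<sigma>\<^sup>2 d\<close>.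
\<close>

section \<open>Testing a point against a mixture\<close>

text \<open>Here \<open>t\<close> is the value of the estimator and \<open>p\<close> the likelihood
  ratio of the mixture at one observation. For \<open>p \<le> 1\<close>, multiply
  \<open>\<Lambda>\<^sup>2 \<le> 2 * t\<^sup>2 + 2 * (t - \<Lambda>)\<^sup>2\<close> by
  \<open>p\<close> and drop \<open>p\<close> from the first term. For \<open>p > 1\<close>, insert
  \<open>p\<close> into the second term instead; the excess of \<open>\<Lambda>\<^sup>2 * p\<close>
  over \<open>\<Lambda>\<^sup>2\<close> is covered by the last term, since
  \<open>(p / 2 - 1)\<^sup>2 \<ge> 0\<close>.\<close>

lemma fuzzy_hypotheses_pointwise:
  fixes t \<Lambda> p :: real
  assumes "p \<ge> 0"
  shows "\<Lambda>\<^sup>2 * p \<le> 2 * t\<^sup>2 + 2 * (t - \<Lambda>)\<^sup>2 * p + \<Lambda>\<^sup>2 / 4 * p\<^sup>2"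
proof -
  have split: "\<Lambda>\<^sup>2 \<le> 2 * t\<^sup>2 + 2 * (t - \<Lambda>)\<^sup>2"
    using zero_le_power2[of "2 * t - \<Lambda>"] by (simp add: power2_eq_square algebra_simps)
  show ?thesis
  proof (cases "p \<le> 1")
    case True
    have "\<Lambda>\<^sup>2 * p \<le> (2 * t\<^sup>2 + 2 * (t - \<Lambda>)\<^sup>2) * p"
      by (rule mult_right_mono[OF split assms])
    also have "\<dots> \<le> 2 * t\<^sup>2 + 2 * (t - \<Lambda>)\<^sup>2 * p"
      using mult_left_le[OF True, of "2 * t\<^sup>2"] by (simp add: algebra_simps)
    finally show ?thesis by (simp add: add_increasing2)
  next
    case False
    have "\<Lambda>\<^sup>2 * p - \<Lambda>\<^sup>2 / 4 * p\<^sup>2 \<le> \<Lambda>\<^sup>2"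
      using zero_le_power2[of "\<Lambda> * (p / 2 - 1)"] by (simp add: power2_eq_square algebra_simps)
    moreover have "2 * (t - \<Lambda>)\<^sup>2 \<le> 2 * (t - \<Lambda>)\<^sup>2 * p"
      using mult_left_mono[of 1 p "2 * (t - \<Lambda>)\<^sup>2"] False by simp
    ultimately show ?thesis using split by linarith
  qed
qed

text \<open>The pointwise inequality is integrated with \<open>p\<close> the average of the
  densities. By \<open>chi2\<close> this average has second moment at most 2, so the weight 1/4
  leaves \<open>\<Lambda>\<^sup>2 \<le> 4 * R + \<Lambda>\<^sup>2 / 2\<close>.\<close>

lemma fuzzy_hypotheses_bound:
  fixes p :: "'b \<Rightarrow> 'a \<Rightarrow> real" and T :: "'a \<Rightarrow> real" and R :: ennreal
  assumes F: "finite F" "F \<noteq> {}"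
    and p[measurable]: "\<And>f. f \<in> F \<Longrightarrow> p f \<in> borel_measurable M"
    and p_nonneg: "\<And>f x. p f x \<ge> 0"
    and p_prob: "\<And>f. f \<in> F \<Longrightarrow> (\<integral>\<^sup>+ x. ennreal (p f x) \<partial>M) = 1"
    and chi2: "(\<Sum>f\<in>F. \<Sum>g\<in>F. \<integral>\<^sup>+ x. ennreal (p f x * p g x) \<partial>M) \<le> ennreal (2 * (real (card F))\<^sup>2)"
    and T[measurable]: "T \<in> borel_measurable M"
    and risk0: "(\<integral>\<^sup>+ x. ennreal ((T x)\<^sup>2) \<partial>M) \<le> R"
    and risk1: "\<And>f. f \<in> F \<Longrightarrow> (\<integral>\<^sup>+ x. ennreal (p f x * (T x - \<Lambda>)\<^sup>2) \<partial>M) \<le> R"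
  shows "ennreal (\<Lambda>\<^sup>2 / 8) \<le> R"
proof (cases "R = \<infinity>")
  case False
  define n where "n = real (card F)"
  have n: "n > 0" using F by (simp add: n_def card_gt_0_iff)
  have n_F: "ennreal n = of_nat (card F)" by (simp add: n_def ennreal_of_nat_eq_real_of_nat)
  define P where "P x = (\<Sum>f\<in>F. p f x) / n" for x
  have P_nonneg: "P x \<ge> 0" for x
    using n p_nonneg by (simp add: P_def sum_nonneg)
  have [measurable]: "P \<in> borel_measurable M"
    unfolding P_def by measurable
  \<comment> \<open>With \<open>h\<close> the squared error this reduces the risk under the mixture
    to \<open>risk1\<close>. Applied with \<open>h = P\<close> and then with \<open>h = p f\<close>,
    it expands the second moment of \<open>P\<close> into the double sum in
    \<open>chi2\<close>.\<close>
  have average: "(\<integral>\<^sup>+ x. ennreal (h x * P x) \<partial>M)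
      = ennreal (1 / n) * (\<Sum>f\<in>F. \<integral>\<^sup>+ x. ennreal (h x * p f x) \<partial>M)"
    if [measurable]: "h \<in> borel_measurable M" and h: "\<And>x. h x \<ge> 0" for h
  proof -
    have "ennreal (h x * P x) = ennreal (1 / n) * (\<Sum>f\<in>F. ennreal (h x * p f x))" for x
      using n h p_nonneg
      by (simp add: P_def sum_ennreal ennreal_mult'[symmetric] sum_distrib_left[symmetric]
          sum_divide_distrib[symmetric] mult_nonneg_nonneg sum_nonneg)
    then show ?thesis
      by (simp add: nn_integral_cmult nn_integral_sum)
  qed
  have P1: "(\<integral>\<^sup>+ x. ennreal (\<Lambda>\<^sup>2 * P x) \<partial>M) = ennreal (\<Lambda>\<^sup>2)"
  proof -
    have "(\<integral>\<^sup>+ x. ennreal (1 * P x) \<partial>M) = ennreal (1 / n) * ennreal n"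
      by (subst average) (simp_all add: p_prob n_F)
    then have "(\<integral>\<^sup>+ x. ennreal (P x) \<partial>M) = 1"
      using n by (simp add: ennreal_mult'[symmetric])
    then show ?thesis
      by (simp add: ennreal_mult' nn_integral_cmult)
  qed
  have risk_P: "(\<integral>\<^sup>+ x. ennreal (2 * (T x - \<Lambda>)\<^sup>2 * P x) \<partial>M) \<le> 2 * R"
  proof -
    have "(\<integral>\<^sup>+ x. ennreal ((T x - \<Lambda>)\<^sup>2 * P x) \<partial>M)
        = ennreal (1 / n) * (\<Sum>f\<in>F. \<integral>\<^sup>+ x. ennreal ((T x - \<Lambda>)\<^sup>2 * p f x) \<partial>M)"
      by (rule average) auto
    also have "\<dots> \<le> ennreal (1 / n) * (\<Sum>f\<in>F. R)"
      using risk1 by (intro mult_left_mono sum_mono) (auto simp: mult.commute)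
    also have "\<dots> = ennreal (1 / n) * ennreal n * R"
      by (simp add: n_F mult.assoc)
    also have "\<dots> = R"
      using n by (simp add: ennreal_mult'[symmetric])
    finally show ?thesis
      by (simp add: ennreal_mult' nn_integral_cmult mult.assoc mult_left_mono)
  qed
  have P2: "(\<integral>\<^sup>+ x. ennreal (\<Lambda>\<^sup>2 / 4 * (P x)\<^sup>2) \<partial>M) \<le> ennreal (\<Lambda>\<^sup>2 / 2)"
  proof -
    have "(\<integral>\<^sup>+ x. ennreal ((P x)\<^sup>2) \<partial>M)
        = ennreal (1 / n) * (\<Sum>f\<in>F. \<integral>\<^sup>+ x. ennreal (p f x * P x) \<partial>M)"
      using average[of P] P_nonneg by (simp add: power2_eq_square mult.commute)
    also have "\<dots> = ennreal (1 / n) * (\<Sum>f\<in>F. ennreal (1 / n) *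
        (\<Sum>g\<in>F. \<integral>\<^sup>+ x. ennreal (p f x * p g x) \<partial>M))"
      using average p_nonneg by simp
    also have "\<dots> = ennreal (1 / n) * ennreal (1 / n) *
        (\<Sum>f\<in>F. \<Sum>g\<in>F. \<integral>\<^sup>+ x. ennreal (p f x * p g x) \<partial>M)"
      by (simp add: sum_distrib_left mult.assoc)
    also have "\<dots> \<le> ennreal (1 / n) * ennreal (1 / n) * ennreal (2 * n\<^sup>2)"
      using chi2 by (intro mult_left_mono) (auto simp: n_def)
    also have "\<dots> = ennreal 2"
      using n by (simp add: ennreal_mult'[symmetric] power2_eq_square del: ennreal_numeral)
    finally have "ennreal (\<Lambda>\<^sup>2 / 4) * (\<integral>\<^sup>+ x. ennreal ((P x)\<^sup>2) \<partial>M)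
        \<le> ennreal (\<Lambda>\<^sup>2 / 4) * ennreal 2"
      by (rule mult_left_mono) simp
    also have "ennreal (\<Lambda>\<^sup>2 / 4) * (\<integral>\<^sup>+ x. ennreal ((P x)\<^sup>2) \<partial>M)
        = (\<integral>\<^sup>+ x. ennreal (\<Lambda>\<^sup>2 / 4 * (P x)\<^sup>2) \<partial>M)"
      by (subst nn_integral_cmult[symmetric]) (auto simp: ennreal_mult'[symmetric])
    also have "ennreal (\<Lambda>\<^sup>2 / 4) * ennreal 2 = ennreal (\<Lambda>\<^sup>2 / 2)"
      by (simp add: ennreal_mult'[symmetric] del: ennreal_numeral)
    finally show ?thesis .
  qed
  have "ennreal (\<Lambda>\<^sup>2) \<le> (\<integral>\<^sup>+ x. ennreal (2 * (T x)\<^sup>2) + ennreal (2 * (T x - \<Lambda>)\<^sup>2 * P x)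
      + ennreal (\<Lambda>\<^sup>2 / 4 * (P x)\<^sup>2) \<partial>M)"
    unfolding P1[symmetric] using P_nonneg fuzzy_hypotheses_pointwise[OF P_nonneg]
    by (intro nn_integral_mono) (simp add: ennreal_plus[symmetric] del: ennreal_plus)
  also have "\<dots> = 2 * (\<integral>\<^sup>+ x. ennreal ((T x)\<^sup>2) \<partial>M)
      + (\<integral>\<^sup>+ x. ennreal (2 * (T x - \<Lambda>)\<^sup>2 * P x) \<partial>M)
      + (\<integral>\<^sup>+ x. ennreal (\<Lambda>\<^sup>2 / 4 * (P x)\<^sup>2) \<partial>M)"
    by (simp add: nn_integral_add nn_integral_cmult ennreal_mult')
  also have "\<dots> \<le> 2 * R + 2 * R + ennreal (\<Lambda>\<^sup>2 / 2)"
    using risk0 risk_P P2 by (intro add_mono mult_left_mono) auto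
  finally have main: "ennreal (\<Lambda>\<^sup>2) \<le> 2 * R + 2 * R + ennreal (\<Lambda>\<^sup>2 / 2)" .
  \<comment> \<open>For finite \<open>R\<close> the inequality is solved over the reals, where
    \<open>\<Lambda>\<^sup>2 / 2\<close> can be subtracted.\<close>
  obtain \<rho> where \<rho>: "\<rho> \<ge> 0" "R = ennreal \<rho>"
    using False by (cases R) auto
  have "ennreal (\<Lambda>\<^sup>2) \<le> ennreal (2 * \<rho> + 2 * \<rho> + \<Lambda>\<^sup>2 / 2)"
    using main \<rho> by (subst ennreal_plus, simp, simp, subst ennreal_plus) (simp_all add: ennreal_mult')
  then have "\<Lambda>\<^sup>2 \<le> 2 * \<rho> + 2 * \<rho> + \<Lambda>\<^sup>2 / 2"
    using \<rho> by (subst (asm) ennreal_le_iff) auto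
  then show ?thesis
    using \<rho> by (simp add: ennreal_le_iff)
qed simp

section \<open>Gaussian observation laws and their likelihood ratios\<close>

text \<open>The map from noise to observations acts coordinatewise, so it pulls boxes back to boxes,
  and agreement on boxes determines a product measure.\<close>

lemma obs_law_eq_PiM:
  assumes "\<sigma> > 0"
  shows "obs_law d \<sigma> \<theta> = (\<Pi>\<^sub>M j\<in>{1..d}. density lborel (normal_density (\<theta> j) \<sigma>))"
proof -
  interpret std: prob_space "density lborel std_normal_density"
    by (rule prob_space_normal_density) simp
  interpret N0: product_sigma_finite "\<lambda>j::nat. density lborel std_normal_density"
    by standard
  interpret N: product_sigma_finite "\<lambda>j. density lborel (normal_density (\<theta> j) \<sigma>)"
    by (intro product_sigma_finite.intro prob_space_imp_sigma_finite prob_space_normal_density assms)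
  have affine: "distr (density lborel std_normal_density) borel (\<lambda>x. \<theta> j + \<sigma> * x)
      = density lborel (normal_density (\<theta> j) \<sigma>)" for j
  proof -
    have "distributed (density lborel std_normal_density) lborel (\<lambda>x. x) std_normal_density"
      by (auto simp: distributed_def distr_id2)
    from std.normal_density_affine[OF this, of \<sigma> "\<theta> j"] assms
    have "distributed (density lborel std_normal_density) lborel (\<lambda>x. \<theta> j + \<sigma> * x)
        (normal_density (\<theta> j) \<sigma>)" by simp
    then show ?thesis
      by (auto simp: distributed_def cong: distr_cong)
  qed
  let ?h = "\<lambda>\<xi>. \<lambda>j\<in>{1..d}. \<theta> j + \<sigma> * \<xi> j"
  have meas: "?h \<in> noise_law d \<rightarrow>\<^sub>M borel_vec d"
    unfolding noise_law_def borel_vec_def by measurable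
  show ?thesis
  proof (rule N.PiM_eqI)
    show "sets (obs_law d \<sigma> \<theta>)
        = sets (\<Pi>\<^sub>M j\<in>{1..d}. density lborel (normal_density (\<theta> j) \<sigma>))"
      unfolding obs_law_def borel_vec_def sets_distr by (rule sets_PiM_cong) auto
  next
    fix A assume A: "\<And>i. i \<in> {1..d} \<Longrightarrow> A i \<in> sets (density lborel (normal_density (\<theta> i) \<sigma>))"
    have "emeasure (obs_law d \<sigma> \<theta>) (Pi\<^sub>E {1..d} A)
        = emeasure (noise_law d) (?h -` Pi\<^sub>E {1..d} A \<inter> space (noise_law d))"
      unfolding obs_law_def
    proof (rule emeasure_distr[OF meas])
      show "Pi\<^sub>E {1..d} A \<in> sets (borel_vec d)"
        using A unfolding borel_vec_def by (intro sets_PiM_I_finite) auto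
    qed
    also have "?h -` Pi\<^sub>E {1..d} A \<inter> space (noise_law d)
        = (\<Pi>\<^sub>E j\<in>{1..d}. (\<lambda>x. \<theta> j + \<sigma> * x) -` A j)"
      unfolding noise_law_def by (auto simp: space_PiM PiE_def Pi_def)
    also have "emeasure (noise_law d) \<dots>
        = (\<Prod>j\<in>{1..d}. emeasure (density lborel std_normal_density) ((\<lambda>x. \<theta> j + \<sigma> * x) -` A j))"
      unfolding noise_law_def using A
      by (intro N0.emeasure_PiM) (auto intro!: measurable_sets_borel[where M=borel])
    also have "\<dots> = (\<Prod>j\<in>{1..d}. emeasure (density lborel (normal_density (\<theta> j) \<sigma>)) (A j))"
    proof (rule prod.cong[OF refl])
      fix j assume "j \<in> {1..d}"
      then show "emeasure (density lborel std_normal_density) ((\<lambda>x. \<theta> j + \<sigma> * x) -` A j)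
          = emeasure (density lborel (normal_density (\<theta> j) \<sigma>)) (A j)"
        using A[of j] by (subst affine[symmetric], subst emeasure_distr) auto
    qed
    finally show "emeasure (obs_law d \<sigma> \<theta>) (Pi\<^sub>E {1..d} A)
        = (\<Prod>i\<in>{1..d}. emeasure (density lborel (normal_density (\<theta> i) \<sigma>)) (A i))" .
  qed simp
qed

text \<open>The density of \<open>P\<^sub>\<theta>\<close> with respect to \<open>P\<^sub>0\<close>.\<close>

definition lik_ratio :: "nat \<Rightarrow> real \<Rightarrow> (nat \<Rightarrow> real) \<Rightarrow> (nat \<Rightarrow> real) \<Rightarrow> real" where
  "lik_ratio d \<sigma> \<theta> y = (\<Prod>j\<in>{1..d}. exp ((\<theta> j * y j - (\<theta> j)\<^sup>2 / 2) / \<sigma>\<^sup>2))"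

lemma normal_density_shift:
  assumes "\<sigma> > 0"
  shows "normal_density \<mu> \<sigma> x = normal_density 0 \<sigma> x * exp ((\<mu> * x - \<mu>\<^sup>2 / 2) / \<sigma>\<^sup>2)"
  using assms
  by (simp add: normal_density_def exp_add[symmetric] power2_eq_square field_simps)

lemma lik_ratio_nonneg: "lik_ratio d \<sigma> \<theta> y \<ge> 0"
  by (simp add: lik_ratio_def prod_nonneg)

lemma sets_obs_law: "sets (obs_law d \<sigma> \<theta>) = sets (borel_vec d)"
  by (simp add: obs_law_def)

lemma borel_measurable_lik_ratio: "lik_ratio d \<sigma> \<theta> \<in> borel_measurable (borel_vec d)"
  unfolding lik_ratio_def borel_vec_def by measurable

text \<open>Agreement on boxes suffices again: the likelihood ratio and the indicator of a box are
  both products over the coordinates.\<close>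

lemma obs_law_eq_density:
  assumes "\<sigma> > 0"
  shows "obs_law d \<sigma> \<theta> = density (obs_law d \<sigma> (\<lambda>_. 0)) (lik_ratio d \<sigma> \<theta>)"
proof -
  let ?N = "\<lambda>\<mu>. density lborel (normal_density \<mu> \<sigma>)"
  let ?e = "\<lambda>j x. ennreal (exp ((\<theta> j * x - (\<theta> j)\<^sup>2 / 2) / \<sigma>\<^sup>2))"
  interpret N0: product_sigma_finite "\<lambda>j::nat. ?N 0"
    by (intro product_sigma_finite.intro prob_space_imp_sigma_finite prob_space_normal_density assms)
  interpret N: product_sigma_finite "\<lambda>j. ?N (\<theta> j)"
    by (intro product_sigma_finite.intro prob_space_imp_sigma_finite prob_space_normal_density assms)
  have dens: "?N (\<theta> j) = density (?N 0) (?e j)" for j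
    by (subst density_density_eq)
      (auto simp: normal_density_shift[OF assms, of "\<theta> j"] ennreal_mult'[symmetric])
  have "density (obs_law d \<sigma> (\<lambda>_. 0)) (lik_ratio d \<sigma> \<theta>) = (\<Pi>\<^sub>M j\<in>{1..d}. ?N (\<theta> j))"
  proof (rule N.PiM_eqI)
    show "sets (density (obs_law d \<sigma> (\<lambda>_. 0)) (lik_ratio d \<sigma> \<theta>)) = sets (\<Pi>\<^sub>M j\<in>{1..d}. ?N (\<theta> j))"
      by (simp add: sets_obs_law borel_vec_def cong: sets_PiM_cong)
  next
    fix A assume A: "\<And>i. i \<in> {1..d} \<Longrightarrow> A i \<in> sets (?N (\<theta> i))"
    have A': "Pi\<^sub>E {1..d} A \<in> sets (borel_vec d)"
      using A unfolding borel_vec_def by (intro sets_PiM_I_finite) auto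
    have "emeasure (density (obs_law d \<sigma> (\<lambda>_. 0)) (lik_ratio d \<sigma> \<theta>)) (Pi\<^sub>E {1..d} A)
      = (\<integral>\<^sup>+ y. ennreal (lik_ratio d \<sigma> \<theta> y) * indicator (Pi\<^sub>E {1..d} A) y \<partial>obs_law d \<sigma> (\<lambda>_. 0))"
      using A' borel_measurable_lik_ratio
      by (intro emeasure_density) (auto simp: sets_obs_law measurable_cong_sets[OF sets_obs_law refl])
    also have "\<dots> = (\<integral>\<^sup>+ y. (\<Prod>j\<in>{1..d}. ?e j (y j) * indicator (A j) (y j)) \<partial>(\<Pi>\<^sub>M j\<in>{1..d}. ?N 0))"
      unfolding obs_law_eq_PiM[OF assms]
    proof (rule nn_integral_cong)
      fix y assume y: "y \<in> space (\<Pi>\<^sub>M j\<in>{1..d}. ?N 0)"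
      \<comment> \<open>Membership of \<open>y\<close> in the space supplies extensionality, which
        the box demands and the coordinate indicators do not see.\<close>
      have "(\<Prod>j\<in>{1..d}. indicator (A j) (y j)) = (indicator (Pi\<^sub>E {1..d} A) y :: ennreal)"
        using y by (auto simp: indicator_def space_PiM PiE_def Pi_def prod_zero)
      then show "ennreal (lik_ratio d \<sigma> \<theta> y) * indicator (Pi\<^sub>E {1..d} A) y
          = (\<Prod>j\<in>{1..d}. ?e j (y j) * indicator (A j) (y j))"
        by (simp add: lik_ratio_def prod_ennreal prod.distrib)
    qed
    also have "\<dots> = (\<Prod>j\<in>{1..d}. \<integral>\<^sup>+ x. ?e j x * indicator (A j) x \<partial>?N 0)"
      using A by (intro N0.product_nn_integral_prod) auto
    also have "\<dots> = (\<Prod>j\<in>{1..d}. emeasure (?N (\<theta> j)) (A j))"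
      using A by (intro prod.cong refl) (simp add: dens emeasure_density)
    finally show "emeasure (density (obs_law d \<sigma> (\<lambda>_. 0)) (lik_ratio d \<sigma> \<theta>)) (Pi\<^sub>E {1..d} A)
        = (\<Prod>i\<in>{1..d}. emeasure (?N (\<theta> i)) (A i))" .
  qed simp
  then show ?thesis by (simp add: obs_law_eq_PiM[OF assms])
qed

text \<open>In each coordinate the factors for shifts \<open>a\<close> and \<open>b\<close> multiply
  to \<open>exp (a * b / \<sigma>\<^sup>2)\<close> times the factor for the shift
  \<open>a + b\<close>, which has integral 1.\<close>

lemma nn_integral_lik_ratio_mult:
  assumes "\<sigma> > 0"
  shows "(\<integral>\<^sup>+ y. ennreal (lik_ratio d \<sigma> \<theta> y * lik_ratio d \<sigma> \<eta> y) \<partial>obs_law d \<sigma> (\<lambda>_. 0))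
    = ennreal (exp ((\<Sum>j=1..d. \<theta> j * \<eta> j) / \<sigma>\<^sup>2))"
proof -
  let ?N = "\<lambda>\<mu>. density lborel (normal_density \<mu> \<sigma>)"
  let ?e = "\<lambda>\<mu> x. exp ((\<mu> * x - \<mu>\<^sup>2 / 2) / \<sigma>\<^sup>2)"
  interpret N0: product_sigma_finite "\<lambda>j::nat. ?N 0"
    by (intro product_sigma_finite.intro prob_space_imp_sigma_finite prob_space_normal_density assms)
  have coord: "(\<integral>\<^sup>+ x. ennreal (?e a x * ?e b x) \<partial>?N 0) = ennreal (exp (a * b / \<sigma>\<^sup>2))" for a b
  proof -
    have "?e a x * ?e b x = exp (a * b / \<sigma>\<^sup>2) * ?e (a + b) x" for x
      unfolding exp_add[symmetric] using assms by (simp add: power2_eq_square field_simps)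
    then have "(\<integral>\<^sup>+ x. ennreal (?e a x * ?e b x) \<partial>?N 0)
        = (\<integral>\<^sup>+ x. ennreal (exp (a * b / \<sigma>\<^sup>2)) * ennreal (normal_density (a + b) \<sigma> x) \<partial>lborel)"
      by (subst nn_integral_density)
        (auto simp: normal_density_shift[OF assms, of "a + b"] ennreal_mult'[symmetric] mult_ac)
    also have "\<dots> = ennreal (exp (a * b / \<sigma>\<^sup>2)) * emeasure (?N (a + b)) UNIV"
      by (subst nn_integral_cmult) (auto simp: emeasure_density)
    also have "emeasure (?N (a + b)) UNIV = 1"
      using prob_space.emeasure_space_1[OF prob_space_normal_density[OF assms, of "a + b"]] by simp
    finally show ?thesis by simp
  qed
  have "(\<integral>\<^sup>+ y. ennreal (lik_ratio d \<sigma> \<theta> y * lik_ratio d \<sigma> \<eta> y) \<partial>obs_law d \<sigma> (\<lambda>_. 0))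
      = (\<integral>\<^sup>+ y. (\<Prod>j\<in>{1..d}. ennreal (?e (\<theta> j) (y j) * ?e (\<eta> j) (y j))) \<partial>(\<Pi>\<^sub>M j\<in>{1..d}. ?N 0))"
    unfolding obs_law_eq_PiM[OF assms]
    by (intro nn_integral_cong) (simp add: lik_ratio_def prod_ennreal prod.distrib[symmetric])
  also have "\<dots> = (\<Prod>j\<in>{1..d}. \<integral>\<^sup>+ x. ennreal (?e (\<theta> j) x * ?e (\<eta> j) x) \<partial>?N 0)"
    by (intro N0.product_nn_integral_prod) auto
  also have "\<dots> = ennreal (\<Prod>j\<in>{1..d}. exp (\<theta> j * \<eta> j / \<sigma>\<^sup>2))"
    by (simp only: coord) (simp add: prod_ennreal)
  also have "(\<Prod>j\<in>{1..d}. exp (\<theta> j * \<eta> j / \<sigma>\<^sup>2)) = exp ((\<Sum>j=1..d. \<theta> j * \<eta> j) / \<sigma>\<^sup>2)"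
    by (simp add: exp_sum sum_divide_distrib)
  finally show ?thesis .
qed


text \<open>Brings every risk under the law P_0, the base measure to which
  \<open>fuzzy_hypotheses_bound\<close> is applied.\<close>

lemma mean_squared_error_eq_lik_ratio:
  assumes "\<sigma> > 0" and "T \<in> borel_measurable (borel_vec d)"
  shows "mean_squared_error d \<sigma> T \<theta>
    = (\<integral>\<^sup>+ y. ennreal (lik_ratio d \<sigma> \<theta> y * (T y - linear_functional d \<theta>)\<^sup>2) \<partial>obs_law d \<sigma> (\<lambda>_. 0))"
proof -
  note [measurable_cong] = sets_obs_law
  note [measurable] = assms(2) borel_measurable_lik_ratio
  show ?thesis
    unfolding mean_squared_error_def
    by (subst obs_law_eq_density[OF assms(1)], subst nn_integral_density)
      (auto simp: ennreal_mult'[symmetric] lik_ratio_nonneg)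
qed

section \<open>Spike vectors with one spike per block\<close>

text \<open>
  The first \<open>s * b\<close> coordinates are cut into \<open>s\<close> blocks of length \<open>b\<close>, and \<open>f\<close> selects one
  position in every block. Compared with uniformly random supports of size \<open>s\<close>, this makes the
  overlap of two independent supports a sum of independent indicators.
\<close>

definition spike_support :: "nat \<Rightarrow> nat \<Rightarrow> (nat \<Rightarrow> nat) \<Rightarrow> nat set" where
  "spike_support s b f = (\<lambda>k. 1 + (k * b + f k)) ` {..<s}"

definition spike_vector :: "nat \<Rightarrow> nat \<Rightarrow> nat \<Rightarrow> real \<Rightarrow> (nat \<Rightarrow> nat) \<Rightarrow> nat \<Rightarrow> real" where
  "spike_vector d s b \<rho> f = (\<lambda>j\<in>{1..d}. if j \<in> spike_support s b f then \<rho> else 0)"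

lemma block_position_eq_iff:
  fixes k l b x y :: nat
  assumes "x < b" "y < b"
  shows "k * b + x = l * b + y \<longleftrightarrow> k = l \<and> x = y"
proof
  assume eq: "k * b + x = l * b + y"
  have "(k * b + x) div b = k" "(l * b + y) div b = l"
    using assms by simp_all
  with eq have "k = l" by metis
  with eq show "k = l \<and> x = y" by simp
qed simp

context
  fixes d s b :: nat
  assumes blocks: "s * b \<le> d"
begin

lemma spike_support_subset:
  assumes "f \<in> {..<s} \<rightarrow>\<^sub>E {..<b}"
  shows "spike_support s b f \<subseteq> {1..d}"
proof
  fix j assume "j \<in> spike_support s b f"
  then obtain k where k: "k < s" "j = 1 + (k * b + f k)"
    by (auto simp: spike_support_def)
  have "f k < b" using assms k(1) by (auto simp: PiE_def Pi_def)
  then have "j \<le> (k + 1) * b" using k(2) by simp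
  also have "\<dots> \<le> s * b" using k(1) by (intro mult_right_mono) auto
  finally show "j \<in> {1..d}" using blocks k(2) by simp
qed

text \<open>Positions in different blocks never coincide, so supports meet exactly in the blocks
  where the selections agree.\<close>

lemma card_spike_support_Int:
  assumes "f \<in> {..<s} \<rightarrow>\<^sub>E {..<b}" "g \<in> {..<s} \<rightarrow>\<^sub>E {..<b}"
  shows "card (spike_support s b f \<inter> spike_support s b g) = card {k\<in>{..<s}. f k = g k}"
proof -
  have lt: "f k < b" "g k < b" if "k < s" for k
    using assms that by (auto simp: PiE_def Pi_def)
  have "spike_support s b f \<inter> spike_support s b g
      = (\<lambda>k. 1 + (k * b + f k)) ` {k\<in>{..<s}. f k = g k}"
    unfolding spike_support_def by (force simp: block_position_eq_iff lt image_iff)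
  moreover have "inj_on (\<lambda>k. 1 + (k * b + f k)) {k\<in>{..<s}. f k = g k}"
    by (auto simp: inj_on_def block_position_eq_iff lt)
  ultimately show ?thesis by (simp only: card_image)
qed

text \<open>Used with \<open>h\<close> the identity for \<open>L\<close>, and with
  \<open>h x = \<bar>x\<bar> powr q\<close> for the norm.\<close>

lemma sum_spike_vector:
  assumes "f \<in> {..<s} \<rightarrow>\<^sub>E {..<b}" and "h 0 = 0"
  shows "(\<Sum>j=1..d. h (spike_vector d s b \<rho> f j)) = real s * h \<rho>"
proof -
  have "(\<Sum>j=1..d. h (spike_vector d s b \<rho> f j)) = (\<Sum>j\<in>spike_support s b f. h \<rho>)"
    using spike_support_subset[OF assms(1)] assms(2)
    by (intro sum.mono_neutral_cong_right) (auto simp: spike_vector_def)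
  \<comment> \<open>A selection agrees with itself in all \<open>s\<close> blocks, so the overlap
    formula gives the size of the support.\<close>
  also have "\<dots> = real s * h \<rho>"
    using card_spike_support_Int[OF assms(1) assms(1)] by simp
  finally show ?thesis .
qed

lemma sum_spike_vector_mult:
  assumes "f \<in> {..<s} \<rightarrow>\<^sub>E {..<b}" "g \<in> {..<s} \<rightarrow>\<^sub>E {..<b}"
  shows "(\<Sum>j=1..d. spike_vector d s b \<rho> f j * spike_vector d s b \<rho> g j)
    = real (card {k\<in>{..<s}. f k = g k}) * \<rho>\<^sup>2"
proof -
  have "(\<Sum>j=1..d. spike_vector d s b \<rho> f j * spike_vector d s b \<rho> g j)
      = (\<Sum>j\<in>spike_support s b f \<inter> spike_support s b g. \<rho>\<^sup>2)"
    using spike_support_subset[OF assms(1)]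
    by (intro sum.mono_neutral_cong_right) (auto simp: spike_vector_def power2_eq_square)
  then show ?thesis by (simp add: card_spike_support_Int[OF assms])
qed

lemma linear_functional_spike_vector:
  assumes "f \<in> {..<s} \<rightarrow>\<^sub>E {..<b}"
  shows "linear_functional d (spike_vector d s b \<rho> f) = real s * \<rho>"
  unfolding linear_functional_def using sum_spike_vector[OF assms, of "\<lambda>x. x"] by simp

lemma spike_vector_in_q_ball:
  assumes "f \<in> {..<s} \<rightarrow>\<^sub>E {..<b}" and "q > 0" "\<rho> \<ge> 0" and "\<rho> * real s powr (1 / q) \<le> r"
  shows "spike_vector d s b \<rho> f \<in> q_ball d q r"
proof -
  have "q_norm d q (spike_vector d s b \<rho> f) = (real s * \<rho> powr q) powr (1 / q)"
    unfolding q_norm_def using sum_spike_vector[OF assms(1), of "\<lambda>x. \<bar>x\<bar> powr q"] assms by simp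
  also have "\<dots> = \<rho> * real s powr (1 / q)"
    using assms by (simp add: powr_mult powr_powr)
  finally show ?thesis
    using assms by (simp add: q_ball_def Rvec_def spike_vector_def)
qed

end

section \<open>The second moment of the mixture\<close>

text \<open>For fixed \<open>f\<close> the power is a product over blocks, so the sum over
  \<open>g\<close> factorizes. In each block one position matches and contributes \<open>E\<close>,
  the other \<open>b - 1\<close> contribute 1; the result does not depend on
  \<open>f\<close>.\<close>

lemma sum_power_card_agree:
  fixes E :: real
  shows "(\<Sum>f\<in>{..<s} \<rightarrow>\<^sub>E {..<b}. \<Sum>g\<in>{..<s} \<rightarrow>\<^sub>E {..<b}. E ^ card {k\<in>{..<s}. f k = g k})
    = (real b ^ s) * (real b - 1 + E) ^ s"
proof -
  have inner: "(\<Sum>g\<in>{..<s} \<rightarrow>\<^sub>E {..<b}. E ^ card {k\<in>{..<s}. f k = g k}) = (real b - 1 + E) ^ s"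
    if f: "f \<in> {..<s} \<rightarrow>\<^sub>E {..<b}" for f
  proof -
    have "E ^ card {k\<in>{..<s}. f k = g k} = (\<Prod>k<s. if f k = g k then E else 1)" for g
      by (simp add: prod.inter_filter[symmetric])
    then have "(\<Sum>g\<in>{..<s} \<rightarrow>\<^sub>E {..<b}. E ^ card {k\<in>{..<s}. f k = g k})
        = (\<Prod>k<s. \<Sum>y<b. if f k = y then E else 1)"
      by (simp add: prod_sum_PiE)
    also have "\<dots> = (\<Prod>k<s. real b - 1 + E)"
    proof (rule prod.cong[OF refl])
      fix k assume "k \<in> {..<s}"
      then have "f k \<in> {..<b}" using f by (auto simp: PiE_def Pi_def)
      then show "(\<Sum>y<b. if f k = y then E else 1) = real b - 1 + E"
        by (subst sum.remove[of _ "f k"]) (auto simp: sum.If_cases Int_def)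
    qed
    finally show ?thesis by simp
  qed
  have "(\<Sum>f\<in>{..<s} \<rightarrow>\<^sub>E {..<b}. \<Sum>g\<in>{..<s} \<rightarrow>\<^sub>E {..<b}. E ^ card {k\<in>{..<s}. f k = g k})
      = (\<Sum>f\<in>{..<s} \<rightarrow>\<^sub>E {..<b}. (real b - 1 + E) ^ s)"
    by (intro sum.cong refl inner)
  then show ?thesis by (simp add: card_PiE)
qed

text \<open>The assumption forces \<open>exp x - 1 \<le> b / (2 * s)\<close> for
  \<open>b = d div s\<close>. Each block then contributes at most
  \<open>b * (1 + 1 / (2 * s))\<close>, and the \<open>s\<close>-th power of the last factor is at
  most \<open>exp (1 / 2) \<le> 2\<close>.\<close>

lemma chi_square_factor_le:
  fixes x :: real
  assumes "1 \<le> s" "s \<le> d" and x: "4 * x \<le> ln (1 + real d / (real s)\<^sup>2)"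
  shows "(real (d div s) - 1 + exp x) ^ s \<le> 2 * real (d div s) ^ s"
proof -
  define b where "b = d div s"
  have b1: "b \<ge> 1"
    using assms div_le_mono[OF assms(2), of s] by (simp add: b_def)
  \<comment> \<open>Rounding in \<open>d div s\<close> costs at most a factor 2.\<close>
  have "d < s * (b + 1)"
    using assms(1) unfolding b_def by (simp add: dividend_less_times_div)
  also have "\<dots> \<le> s * (2 * b)"
    using b1 by (intro mult_left_mono) auto
  finally have "real d \<le> real (2 * s * b)" by (simp only: of_nat_le_iff)
  then have d_le: "real d \<le> 2 * real s * real b" by simp
  \<comment> \<open>Bernoulli converts the factor 4 in the exponent into a factor 4 on
    \<open>exp x - 1\<close>; half of it absorbs the rounding loss.\<close>
  have "1 + 4 * (exp x - 1) \<le> (1 + (exp x - 1)) ^ 4"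
    using Bernoulli_inequality[of "exp x - 1" 4] by simp
  also have "\<dots> = exp (4 * x)" by (simp add: exp_of_nat_mult[of 4 x, simplified])
  also have "\<dots> \<le> 1 + real d / (real s)\<^sup>2"
    using x by (subst ln_ge_iff[symmetric]) (auto intro: add_pos_nonneg)
  also have "\<dots> \<le> 1 + 2 * real s * real b / (real s)\<^sup>2"
    using d_le by (simp add: divide_right_mono)
  also have "\<dots> = 1 + 2 * real b / real s"
    using assms(1) by (simp add: power2_eq_square)
  finally have "exp x - 1 \<le> real b / (2 * real s)" by simp
  then have "real b - 1 + exp x \<le> real b * (1 + 1 / (2 * real s))"
    by (simp add: algebra_simps)
  also have "\<dots> \<le> real b * exp (1 / (2 * real s))"
    by (intro mult_left_mono exp_ge_add_one_self) auto
  finally have "(real b - 1 + exp x) ^ s \<le> (real b * exp (1 / (2 * real s))) ^ s"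
    using b1 by (intro power_mono) (auto intro: add_nonneg_nonneg)
  also have "\<dots> = real b ^ s * exp (1 / 2)"
    using assms(1) by (simp add: power_mult_distrib exp_of_nat_mult[symmetric])
  also have "\<dots> \<le> real b ^ s * 2"
  proof (rule mult_left_mono)
    have "(exp (1 / 2 :: real))\<^sup>2 \<le> 2\<^sup>2"
      using exp_le by (simp add: exp_double[symmetric])
    then show "exp (1 / 2 :: real) \<le> 2" by (rule power2_le_imp_le) simp
  qed simp
  finally show ?thesis by (simp add: b_def mult.commute)
qed

section \<open>The lower bound for a given sparsity and amplitude\<close>

text \<open>\<open>signal\<close> keeps the second moment of the mixture below 2, and
  \<open>norm\<close> places the spike vectors in the ball.\<close>

lemma minimax_risk_ge_sparse:
  assumes "q > 0" "\<sigma> > 0" "\<rho> \<ge> 0" "r \<ge> 0" "1 \<le> s" "s \<le> d"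
    and signal: "4 * \<rho>\<^sup>2 \<le> \<sigma>\<^sup>2 * ln (1 + real d / (real s)\<^sup>2)"
    and norm: "\<rho> * real s powr (1 / q) \<le> r"
  shows "minimax_risk d \<sigma> (q_ball d q r) \<ge> ennreal ((real s * \<rho>)\<^sup>2 / 8)"
  unfolding minimax_risk_def
proof (rule INF_greatest)
  fix T :: "(nat \<Rightarrow> real) \<Rightarrow> real"
  assume T: "T \<in> borel_measurable (borel_vec d)"
  define b where "b = d div s"
  define F where "F = {..<s} \<rightarrow>\<^sub>E {..<b}"
  define \<theta> where "\<theta> = spike_vector d s b \<rho>"
  define R where "R = (SUP \<theta>\<in>q_ball d q r. mean_squared_error d \<sigma> T \<theta>)"
  have blocks: "s * b \<le> d" by (simp add: b_def)
  have b1: "b \<ge> 1"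
    using assms div_le_mono[OF \<open>s \<le> d\<close>, of s] by (simp add: b_def)
  have risk: "mean_squared_error d \<sigma> T \<eta> \<le> R" if "\<eta> \<in> q_ball d q r" for \<eta>
    unfolding R_def by (rule SUP_upper[OF that])
  note meas = measurable_cong_sets[OF sets_obs_law refl]
  have "ennreal ((real s * \<rho>)\<^sup>2 / 8) \<le> R"
  proof (rule fuzzy_hypotheses_bound[where F = F and p = "\<lambda>f. lik_ratio d \<sigma> (\<theta> f)"
        and M = "obs_law d \<sigma> (\<lambda>_. 0)" and T = T])
    show "finite F" by (simp add: F_def finite_PiE)
    show "F \<noteq> {}" using b1 by (auto simp: F_def PiE_eq_empty_iff lessThan_empty_iff)
    show "lik_ratio d \<sigma> (\<theta> f) \<in> borel_measurable (obs_law d \<sigma> (\<lambda>_. 0))" for f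
      by (simp add: meas borel_measurable_lik_ratio)
    show "lik_ratio d \<sigma> (\<theta> f) y \<ge> 0" for f y by (rule lik_ratio_nonneg)
    \<comment> \<open>The product formula with second parameter 0 shows that each likelihood ratio
      integrates to 1.\<close>
    have "lik_ratio d \<sigma> (\<lambda>_. 0) y = 1" for y by (simp add: lik_ratio_def)
    then show "(\<integral>\<^sup>+ y. ennreal (lik_ratio d \<sigma> (\<theta> f) y) \<partial>obs_law d \<sigma> (\<lambda>_. 0)) = 1" for f
      using nn_integral_lik_ratio_mult[OF \<open>\<sigma> > 0\<close>, of d "\<theta> f" "\<lambda>_. 0"] by simp
    show "T \<in> borel_measurable (obs_law d \<sigma> (\<lambda>_. 0))" by (simp add: meas T)
    show "(\<integral>\<^sup>+ y. ennreal ((T y)\<^sup>2) \<partial>obs_law d \<sigma> (\<lambda>_. 0)) \<le> R"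
    proof -
      \<comment> \<open>Vectors of the ball are extensional, so zero is restricted to
        \<open>{1..d}\<close>; the law is unchanged, as it reads only these coordinates.\<close>
      let ?z = "\<lambda>j\<in>{1..d}. 0 :: real"
      have "q_norm d q ?z = 0" by (simp add: q_norm_def)
      then have "?z \<in> q_ball d q r" using \<open>r \<ge> 0\<close> by (simp add: q_ball_def Rvec_def)
      moreover have "obs_law d \<sigma> ?z = obs_law d \<sigma> (\<lambda>_. 0)"
        unfolding obs_law_def by (intro distr_cong) auto
      ultimately show ?thesis
        using risk[of ?z] by (simp add: mean_squared_error_def linear_functional_def)
    qed
    show "(\<integral>\<^sup>+ y. ennreal (lik_ratio d \<sigma> (\<theta> f) y * (T y - real s * \<rho>)\<^sup>2) \<partial>obs_law d \<sigma> (\<lambda>_. 0)) \<le> R"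
      if f: "f \<in> F" for f
    proof -
      have "\<theta> f \<in> q_ball d q r"
        unfolding \<theta>_def using f assms by (intro spike_vector_in_q_ball[OF blocks]) (auto simp: F_def)
      moreover have "linear_functional d (\<theta> f) = real s * \<rho>"
        unfolding \<theta>_def using f by (intro linear_functional_spike_vector[OF blocks]) (simp add: F_def)
      ultimately show ?thesis
        using risk[of "\<theta> f"] mean_squared_error_eq_lik_ratio[OF \<open>\<sigma> > 0\<close> T, of "\<theta> f"] by simp
    qed
    define x where "x = \<rho>\<^sup>2 / \<sigma>\<^sup>2"
    have pair: "(\<integral>\<^sup>+ y. ennreal (lik_ratio d \<sigma> (\<theta> f) y * lik_ratio d \<sigma> (\<theta> g) y) \<partial>obs_law d \<sigma> (\<lambda>_. 0))
        = ennreal (exp x ^ card {k\<in>{..<s}. f k = g k})" if "f \<in> F" "g \<in> F" for f g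
    proof -
      have "(\<Sum>j=1..d. \<theta> f j * \<theta> g j) / \<sigma>\<^sup>2 = real (card {k\<in>{..<s}. f k = g k}) * x"
        unfolding \<theta>_def using that by (subst sum_spike_vector_mult[OF blocks]) (auto simp: F_def x_def)
      then show ?thesis
        by (simp add: nn_integral_lik_ratio_mult[OF \<open>\<sigma> > 0\<close>] exp_of_nat_mult)
    qed
    have "(\<Sum>f\<in>F. \<Sum>g\<in>F. \<integral>\<^sup>+ y. ennreal (lik_ratio d \<sigma> (\<theta> f) y * lik_ratio d \<sigma> (\<theta> g) y)
        \<partial>obs_law d \<sigma> (\<lambda>_. 0)) = ennreal (real b ^ s * (real b - 1 + exp x) ^ s)"
      unfolding sum_power_card_agree[symmetric] F_def[symmetric]
      by (simp add: pair sum_nonneg)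
    also have "real b ^ s * (real b - 1 + exp x) ^ s \<le> real b ^ s * (2 * real b ^ s)"
    proof (rule mult_left_mono)
      have "4 * x \<le> ln (1 + real d / (real s)\<^sup>2)"
        using signal \<open>\<sigma> > 0\<close> by (simp add: x_def field_simps)
      then show "(real b - 1 + exp x) ^ s \<le> 2 * real b ^ s"
        unfolding b_def by (rule chi_square_factor_le[OF \<open>1 \<le> s\<close> \<open>s \<le> d\<close>])
    qed simp
    also have "real b ^ s * (2 * real b ^ s) = 2 * (real (card F))\<^sup>2"
      by (simp add: F_def card_PiE power2_eq_square)
    finally show "(\<Sum>f\<in>F. \<Sum>g\<in>F. \<integral>\<^sup>+ y. ennreal (lik_ratio d \<sigma> (\<theta> f) y * lik_ratio d \<sigma> (\<theta> g) y)
        \<partial>obs_law d \<sigma> (\<lambda>_. 0)) \<le> ennreal (2 * (real (card F))\<^sup>2)"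
      by (simp add: ennreal_leI)
  qed
  then show "ennreal ((real s * \<rho>)\<^sup>2 / 8) \<le> (SUP \<theta>\<in>q_ball d q r. mean_squared_error d \<sigma> T \<theta>)"
    by (simp add: R_def)
qed

section \<open>Choice of sparsity and amplitude\<close>

lemma ln_one_plus_ge_half:
  fixes x :: real
  assumes "0 \<le> x" "x \<le> 1"
  shows "x / 2 \<le> ln (1 + x)"
proof -
  have "exp (x / 2) \<le> 1 + x / 2 + (x / 2)\<^sup>2"
    using assms by (intro exp_bound) auto
  also have "(x / 2)\<^sup>2 \<le> x / 2"
    using assms mult_left_le[of x x] by (simp add: power2_eq_square)
  finally show ?thesis
    using assms by (subst ln_ge_iff) auto
qed

text \<open>The amplitude \<open>\<rho>\<close> attains equality in the signal condition
  \<open>4 * \<rho>\<^sup>2 \<le> \<sigma>\<^sup>2 * l\<close>. Its factor 4 matches the slack in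
  \<open>near\<close>, so the norm constraint still holds.\<close>

lemma minimax_risk_ge_near_sparsity_set:
  assumes "q > 0" "\<sigma> > 0" "r \<ge> 0" "1 \<le> s" "s \<le> d"
    and near: "\<sigma>\<^sup>2 * ln (1 + real d / (real s)\<^sup>2) \<le> 4 * r\<^sup>2 * real s powr (- 2 / q)"
  shows "minimax_risk d \<sigma> (q_ball d q r) \<ge> ennreal (\<sigma>\<^sup>2 * (real s)\<^sup>2 * ln (1 + real d / (real s)\<^sup>2) / 32)"
proof -
  define l where "l = ln (1 + real d / (real s)\<^sup>2)"
  define \<rho> where "\<rho> = \<sigma> * sqrt l / 2"
  have l: "l \<ge> 0" by (simp add: l_def)
  have \<rho>2: "4 * \<rho>\<^sup>2 = \<sigma>\<^sup>2 * l"
    using l by (simp add: \<rho>_def power_mult_distrib power_divide)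
  have s: "real s powr (1 / q) > 0" using assms by simp
  have "(\<rho> * real s powr (1 / q))\<^sup>2 = \<rho>\<^sup>2 * real s powr (2 / q)"
    by (simp add: power_mult_distrib power2_eq_square powr_add[symmetric])
  also have "\<dots> \<le> r\<^sup>2 * real s powr (- 2 / q) * real s powr (2 / q)"
    using near \<rho>2 by (intro mult_right_mono) (auto simp: l_def)
  also have "\<dots> = r\<^sup>2"
    using assms by (simp add: mult.assoc powr_add[symmetric])
  finally have "\<rho> * real s powr (1 / q) \<le> r"
    using \<open>r \<ge> 0\<close> by (rule power2_le_imp_le)
  then have "minimax_risk d \<sigma> (q_ball d q r) \<ge> ennreal ((real s * \<rho>)\<^sup>2 / 8)"
    using assms l \<rho>2 by (intro minimax_risk_ge_sparse) (auto simp: \<rho>_def l_def)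
  also have "(real s * \<rho>)\<^sup>2 / 8 = \<sigma>\<^sup>2 * (real s)\<^sup>2 * l / 32"
    using \<rho>2 by (simp add: power_mult_distrib algebra_simps)
  finally show ?thesis by (simp add: l_def)
qed

text \<open>For \<open>m \<ge> d\<close> the logarithm is comparable to its argument, and membership
  of \<open>m\<close> becomes \<open>\<sigma>\<^sup>2 * d \<le> 2 * r\<^sup>2 * m powr (2 - 2 /
  q)\<close>. This passes down to \<open>d\<close>, which satisfies the relaxed sparsity
  condition.\<close>

lemma minimax_risk_ge_dense:
  assumes "0 < q" "q \<le> 1" "\<sigma> > 0" "r \<ge> 0" "1 \<le> d" "m \<in> sparsity_set d \<sigma> q r" "d \<le> m"
  shows "minimax_risk d \<sigma> (q_ball d q r) \<ge> ennreal (\<sigma>\<^sup>2 * real d / 64)"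
proof -
  have m: "m \<ge> 1" "\<sigma>\<^sup>2 * ln (1 + real d / (real m)\<^sup>2) \<le> r\<^sup>2 * real m powr (- 2 / q)"
    using assms by (auto simp: sparsity_set_def)
  have powr_split: "real n powr (- 2 / q) * (real n)\<^sup>2 = real n powr (2 - 2 / q)" if "n \<ge> 1" for n
    using that by (simp add: powr_add[symmetric] flip: powr_numeral)
  have "real d \<le> real m * real m"
    using mult_mono[of "real d" "real m" 1 "real m"] assms m by simp
  then have "real d / (real m)\<^sup>2 \<le> 1"
    by (simp add: power2_eq_square divide_le_eq)
  then have "real d / (real m)\<^sup>2 / 2 \<le> ln (1 + real d / (real m)\<^sup>2)"
    by (intro ln_one_plus_ge_half) auto
  then have "\<sigma>\<^sup>2 * (real d / (real m)\<^sup>2 / 2) \<le> r\<^sup>2 * real m powr (- 2 / q)"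
    using m(2) by (meson mult_left_mono order_trans zero_le_power2)
  then have "\<sigma>\<^sup>2 * real d \<le> 2 * r\<^sup>2 * (real m powr (- 2 / q) * (real m)\<^sup>2)"
    using m(1) by (simp add: field_simps)
  also have "real m powr (- 2 / q) * (real m)\<^sup>2 = real m powr (2 - 2 / q)"
    by (rule powr_split[OF m(1)])
  \<comment> \<open>Since \<open>q \<le> 1\<close>, the exponent is nonpositive and replacing
    \<open>m\<close> by the smaller \<open>d\<close> increases the power.\<close>
  also have "2 * r\<^sup>2 * real m powr (2 - 2 / q) \<le> 2 * r\<^sup>2 * real d powr (2 - 2 / q)"
    using assms by (intro mult_left_mono powr_mono2') (auto simp: field_simps)
  also have "real d powr (2 - 2 / q) = real d powr (- 2 / q) * (real d)\<^sup>2"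
    by (rule powr_split[symmetric, OF \<open>1 \<le> d\<close>])
  finally have "\<sigma>\<^sup>2 * real d \<le> 2 * r\<^sup>2 * real d powr (- 2 / q) * (real d)\<^sup>2" by (simp add: mult_ac)
  then have "\<sigma>\<^sup>2 * (1 / real d) \<le> 2 * r\<^sup>2 * real d powr (- 2 / q)"
    using assms by (simp add: field_simps power2_eq_square)
  moreover have "\<sigma>\<^sup>2 * ln (1 + real d / (real d)\<^sup>2) \<le> \<sigma>\<^sup>2 * (1 / real d)"
    using assms by (intro mult_left_mono) (auto simp: power2_eq_square intro: ln_add_one_self_le_self)
  moreover have "0 \<le> r\<^sup>2 * real d powr (- 2 / q)" by simp
  ultimately have "\<sigma>\<^sup>2 * ln (1 + real d / (real d)\<^sup>2) \<le> 4 * r\<^sup>2 * real d powr (- 2 / q)"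
    by linarith
  then have "minimax_risk d \<sigma> (q_ball d q r)
      \<ge> ennreal (\<sigma>\<^sup>2 * (real d)\<^sup>2 * ln (1 + real d / (real d)\<^sup>2) / 32)"
    using assms by (intro minimax_risk_ge_near_sparsity_set) auto
  moreover have "\<sigma>\<^sup>2 * real d / 64 \<le> \<sigma>\<^sup>2 * (real d)\<^sup>2 * ln (1 + real d / (real d)\<^sup>2) / 32"
  proof -
    have "1 / real d / 2 \<le> ln (1 + 1 / real d)"
      using assms by (intro ln_one_plus_ge_half) auto
    then have "\<sigma>\<^sup>2 * (real d)\<^sup>2 * (1 / real d / 2) \<le> \<sigma>\<^sup>2 * (real d)\<^sup>2 * ln (1 + 1 / real d)"
      by (rule mult_left_mono) simp
    then show ?thesis using assms by (simp add: power2_eq_square)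
  qed
  ultimately show ?thesis by (meson ennreal_leI order_trans)
qed

section \<open>Empty, infinite and finite sparsity sets\<close>

theorem theorem2:
  fixes q :: real
  assumes "0 < q" and "q \<le> 1"
  shows "\<exists>c::real. c > 0 \<and>
    (\<forall>(d::nat) (r::real) (\<sigma>::real). d \<ge> 1 \<longrightarrow> r > 0 \<longrightarrow> \<sigma> > 0 \<longrightarrow>
      minimax_risk d \<sigma> (q_ball d q r) \<ge> ennreal (c * rate d \<sigma> q r))"
\<comment> \<open>The cases \<open>S = {}\<close> and \<open>m < d\<close> give the constant 1/32;
  for \<open>m \<ge> d\<close> the bound \<open>x / 2 \<le> ln (1 + x)\<close> costs another factor
  2.\<close>
proof (intro exI[of _ "1 / 64"] conjI allI impI)
  fix d :: nat and r \<sigma> :: real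
  assume d: "d \<ge> 1" and r: "r > 0" and \<sigma>: "\<sigma> > 0"
  define S where "S = sparsity_set d \<sigma> q r"
  note dense = minimax_risk_ge_dense[OF assms \<sigma> less_imp_le[OF r] d]
  consider "S = {}" | "infinite S" | "finite S" "S \<noteq> {}" by blast
  then show "ennreal (1 / 64 * rate d \<sigma> q r) \<le> minimax_risk d \<sigma> (q_ball d q r)"
  proof cases
    case 1
    then have rate: "rate d \<sigma> q r = r\<^sup>2"
      by (simp add: rate_def sparsity_level_def S_def zero_enat_def)
    \<comment> \<open>Failure of the condition at \<open>s = 1\<close> is, up to strictness, the
      signal condition for a single spike of height \<open>r / 2\<close>.\<close>
    have "1 \<notin> S" using 1 by simp
    then have "r\<^sup>2 < \<sigma>\<^sup>2 * ln (1 + real d)"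
      by (simp add: S_def sparsity_set_def)
    then have "ennreal ((real 1 * (r / 2))\<^sup>2 / 8) \<le> minimax_risk d \<sigma> (q_ball d q r)"
      using assms r \<sigma> d by (intro minimax_risk_ge_sparse) (auto simp: power_divide)
    moreover have "1 / 64 * rate d \<sigma> q r \<le> (real 1 * (r / 2))\<^sup>2 / 8"
      by (simp add: rate power_divide)
    ultimately show ?thesis by (meson ennreal_leI order_trans)
  next
    case 2
    then obtain m where "m \<in> S" "d \<le> m"
      by (meson infinite_nat_iff_unbounded_le)
    moreover have "rate d \<sigma> q r = \<sigma>\<^sup>2 * real d"
      using 2 infinite_imp_nonempty[OF 2] by (simp add: rate_def sparsity_level_def S_def)
    ultimately show ?thesis using dense[of m] by (simp add: S_def)
  next
    case 3
    define m where "m = Max S"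
    have m: "m \<in> S" using 3 by (simp add: m_def)
    then have m1: "m \<ge> 1" by (simp add: S_def sparsity_set_def)
    have rate: "rate d \<sigma> q r = \<sigma>\<^sup>2 * (real m)\<^sup>2 * ln (1 + real d / (real m)\<^sup>2)"
      using 3 m1 by (simp add: rate_def sparsity_level_def S_def m_def)
    show ?thesis
    proof (cases "d \<le> m")
      case True
      \<comment> \<open>The rate at any finite \<open>m \<ge> 1\<close> is at most its limit
        \<open>\<sigma>\<^sup>2 * d\<close>, which the dense bound reaches up to 1/64.\<close>
      have "1 / 64 * rate d \<sigma> q r \<le> \<sigma>\<^sup>2 * real d / 64"
        using rate_at_infinity_bound[OF m1] by (simp add: rate)
      then show ?thesis
        using dense[OF m[unfolded S_def] True] by (meson ennreal_leI order_trans)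
    next
      case False
      have "0 \<le> r\<^sup>2 * real m powr (- 2 / q)" by simp
      then have "\<sigma>\<^sup>2 * ln (1 + real d / (real m)\<^sup>2) \<le> 4 * r\<^sup>2 * real m powr (- 2 / q)"
        using m unfolding S_def sparsity_set_def mem_Collect_eq by linarith
      then have "ennreal (rate d \<sigma> q r / 32) \<le> minimax_risk d \<sigma> (q_ball d q r)"
        unfolding rate using assms r \<sigma> m1 False by (intro minimax_risk_ge_near_sparsity_set) auto
      moreover have "1 / 64 * rate d \<sigma> q r \<le> rate d \<sigma> q r / 32"
        by (simp add: rate)
      ultimately show ?thesis by (meson ennreal_leI order_trans)
    qed
  qed
qed simp

end
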